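(* Let $k$ be a field of characteristic zero and $B=k[x,y,z]$. Let $m\ge 2$, $n\ge 1$ be integers and $F\in k[t_1,t_2]$ with $F(t_1,0)\notin k$. Put $$f=xz-y^m,\qquad r=xF(x,f)+yf^n,\qquad h=\frac{f^{mn+1}+r^m}{x}\in B,$$ and let $E=E(m,n,F)=\mathrm{Jac}(f,h,\cdot)$. Then $E$ is a locally nilpotent derivation of $B$ with $\mathrm{rk}\,E=3$.
   Context: $\mathrm{Jac}(f,h,\cdot)$ is the derivation $p\mapsto\det J(f,h,p)$, where $J$ is the Jacobian matrix with respect to $x,y,z$. (Here $h$ is a polynomial.) The rank of a derivation $E$ of $k[x,y,z]$ is the least $i$ such that there is a coordinate system $(x_1,x_2,x_3)$, $k[x,y,z]=k[x_1,x_2,x_3]$, with $k[x_{i+1},\dots,x_3]\subseteq\mathrm{Ker}\,E$; rank $3$ means that no variable of $B$ lies in $\mathrm{Ker}\,E$. *)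

theory Defs
  imports "HOL-Computational_Algebra.Polynomial"
begin

text \<open>The polynomial ring B = k[x,y,z] is modelled as the nested polynomial type
  ((k poly) poly) poly: the innermost variable is x, the middle one y, the outermost z.\<close>

type_synonym 'a poly3 = "'a poly poly poly"

definition constB :: "'a::zero \<Rightarrow> 'a poly3" where
  "constB a = [:[:[:a:]:]:]"

definition varX :: "'a::{zero,one} poly3" where
  "varX = [:[:[:0, 1:]:]:]"

definition varY :: "'a::{zero,one} poly3" where
  "varY = [:[:[:0:], [:1:]:]:]"

definition varZ :: "'a::{zero,one} poly3" where
  "varZ = [:[:[:0:]:], [:[:1:]:]:]"

definition dX :: "'a::field poly3 \<Rightarrow> 'a poly3" where
  "dX p = map_poly (map_poly pderiv) p"

definition dY :: "'a::field poly3 \<Rightarrow> 'a poly3" where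
  "dY p = map_poly pderiv p"

definition dZ :: "'a::field poly3 \<Rightarrow> 'a poly3" where
  "dZ p = pderiv p"

text \<open>Jac(f,h,.) : p \<mapsto> det J(f,h,p), the Jacobian determinant with rows
  (f_x,f_y,f_z), (h_x,h_y,h_z), (p_x,p_y,p_z).\<close>

definition Jac :: "'a::field poly3 \<Rightarrow> 'a poly3 \<Rightarrow> 'a poly3 \<Rightarrow> 'a poly3" where
  "Jac f h p =
     dX f * (dY h * dZ p - dZ h * dY p)
   - dY f * (dX h * dZ p - dZ h * dX p)
   + dZ f * (dX h * dY p - dY h * dX p)"

definition is_derivation :: "('a::field poly3 \<Rightarrow> 'a poly3) \<Rightarrow> bool" where
  "is_derivation D \<longleftrightarrow>
     (\<forall>p q. D (p + q) = D p + D q) \<and>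
     (\<forall>a p. D (constB a * p) = constB a * D p) \<and>
     (\<forall>p q. D (p * q) = p * D q + q * D p)"

definition locally_nilpotent :: "('a::field poly3 \<Rightarrow> 'a poly3) \<Rightarrow> bool" where
  "locally_nilpotent D \<longleftrightarrow> (\<forall>p. \<exists>N. (D ^^ N) p = 0)"

definition subst3 :: "'a::field poly3 \<Rightarrow> 'a poly3 \<Rightarrow> 'a poly3 \<Rightarrow> 'a poly3 \<Rightarrow> 'a poly3" where
  "subst3 g1 g2 g3 p =
     poly (map_poly (\<lambda>q. poly (map_poly (\<lambda>r. poly (map_poly constB r) g1) q) g2) p) g3"

definition coord_system :: "'a::field poly3 \<Rightarrow> 'a poly3 \<Rightarrow> 'a poly3 \<Rightarrow> bool" where
  "coord_system g1 g2 g3 \<longleftrightarrow> surj (subst3 g1 g2 g3)"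

inductive_set alg_gen :: "'a::field poly3 set \<Rightarrow> 'a poly3 set" for S where
  const: "constB a \<in> alg_gen S"
| gen: "s \<in> S \<Longrightarrow> s \<in> alg_gen S"
| add: "p \<in> alg_gen S \<Longrightarrow> q \<in> alg_gen S \<Longrightarrow> p + q \<in> alg_gen S"
| mult: "p \<in> alg_gen S \<Longrightarrow> q \<in> alg_gen S \<Longrightarrow> p * q \<in> alg_gen S"

definition deriv_rank :: "('a::field poly3 \<Rightarrow> 'a poly3) \<Rightarrow> nat" where
  "deriv_rank D = (LEAST i. \<exists>g1 g2 g3. coord_system g1 g2 g3 \<and>
       alg_gen (set (drop i [g1, g2, g3])) \<subseteq> {p. D p = 0})"

text \<open>Evaluation of F \<in> k[t1,t2] (outer variable t2, inner t1) at t1 := a, t2 := b.\<close>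

definition eval2 :: "'a::field poly poly \<Rightarrow> 'a poly3 \<Rightarrow> 'a poly3 \<Rightarrow> 'a poly3" where
  "eval2 F a b = poly (map_poly (\<lambda>q. poly (map_poly constB q) a) F) b"

end

theory Submission
  imports Defs
begin

text \<open>
  Applying E and Jac(f,x,.) to the relation xh = f^(mn+1) + r^m gives E r = -h f^n and
  E x = -m r^(m-1) f^n. Up to powers of f, both y and z are polynomials in the elements x, r, f, h,
  on which E is nilpotent; so E is locally nilpotent.

  The kernel is k[f,h]. After inverting fh the ring becomes k[f,h][r] with local slice r, so the
  kernel lies in the localisation of k[f,h]; the denominators cancel because h is nonconstant on
  the line y = z = 0 inside f = 0, and f takes infinitely many values on h = 0.

  If a variable g were in the kernel, its gradient, say \<alpha> grad f + \<beta> grad h with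
  \<alpha>, \<beta> in k[f,h], would vanish nowhere. Let a, b be the constant terms of \<alpha>, \<beta> and put
  p(x) = F(x,0). On the line x = y = 0, where f = h = 0, grad f = (z,0,0) and grad h = (e,0,0) with
  e constant, so az + be has no zero. If p(0) = 0 then e = 0, and z = 0 is a zero. Otherwise
  p is prime to x, and at a root of p on the axis y = z = 0 both f, h and grad h vanish;
  hence a is nonzero and az + be has a zero.
\<close>

section \<open>Derivations and subalgebras of the polynomial ring\<close>

lemma constB_simps:
  "constB 0 = 0" "constB 1 = 1" "constB (a + b) = constB a + constB b"
  "constB (a * b) = constB a * constB b" for a b :: "'a::field"
  by (simp_all add: constB_def one_pCons)

lemma map_poly_additive:
  assumes "\<delta> 0 = 0" "\<And>a b. \<delta> (a + b) = \<delta> a + \<delta> b"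
  shows "map_poly \<delta> (p + q) = map_poly \<delta> p + map_poly \<delta> q"
  by (rule poly_eqI) (simp add: coeff_map_poly assms)

text \<open>A derivation of the coefficient ring acts on polynomials coefficientwise and fixes the
  variable, so the Leibniz rule passes up one layer of the nested polynomial type. \<open>dY\<close>
  uses this once and \<open>dX\<close> twice.\<close>

lemma map_poly_Leibniz:
  fixes \<delta> :: "'a::comm_ring_1 \<Rightarrow> 'a"
  assumes "\<delta> 0 = 0" "\<And>a b. \<delta> (a + b) = \<delta> a + \<delta> b" "\<And>a b. \<delta> (a * b) = a * \<delta> b + b * \<delta> a"
  shows "map_poly \<delta> (p * q) = p * map_poly \<delta> q + q * map_poly \<delta> p"
proof (induction p)
  case 0
  then show ?case by simp
next
  case (pCons a p)
  have "map_poly \<delta> (smult a q) = smult a (map_poly \<delta> q) + smult (\<delta> a) q"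
    by (rule poly_eqI) (simp add: coeff_map_poly assms mult.commute)
  with pCons show ?case
    by (simp add: map_poly_additive[of \<delta>] assms map_poly_pCons algebra_simps)
qed

lemma is_derivationI:
  assumes "\<And>p q. D (p + q) = D p + D q" "\<And>p q. D (p * q) = p * D q + q * D p"
    and "\<And>a. D (constB a) = 0"
  shows "is_derivation D"
  unfolding is_derivation_def by (simp add: assms)

lemma dZ_derivation: "is_derivation dZ"
  by (rule is_derivationI) (simp_all add: dZ_def pderiv_add pderiv_mult constB_def pderiv_pCons)

lemma dY_derivation: "is_derivation dY"
  by (rule is_derivationI) (simp_all add: dY_def map_poly_additive map_poly_Leibniz
      pderiv_add pderiv_mult constB_def map_poly_pCons pderiv_pCons)

lemma dX_derivation: "is_derivation dX"
  by (rule is_derivationI) (simp_all add: dX_def map_poly_additive map_poly_Leibniz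
      pderiv_add pderiv_mult constB_def map_poly_pCons pderiv_pCons)

lemmas partials_derivation = dX_derivation dY_derivation dZ_derivation

lemma partials_var [simp]:
  "dX varX = 1" "dX varY = 0" "dX varZ = 0"
  "dY varX = 0" "dY varY = 1" "dY varZ = 0"
  "dZ varX = 0" "dZ varY = 0" "dZ varZ = 1"
  by (simp_all add: dX_def dY_def dZ_def varX_def varY_def varZ_def map_poly_pCons pderiv_pCons one_pCons)

section \<open>Calculus of derivations and their iterates\<close>

context
  fixes D :: "'k::field poly3 \<Rightarrow> 'k poly3"
  assumes D: "is_derivation D"
begin

lemma deriv_add: "D (p + q) = D p + D q"
  and deriv_mult: "D (p * q) = p * D q + q * D p"
  using D by (auto simp: is_derivation_def)

lemma deriv_one: "D 1 = 0"
  using deriv_mult[of 1 1] by (metis add_cancel_right_right mult_1)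

lemma deriv_const: "D (constB a) = 0"
  using D deriv_one unfolding is_derivation_def by (metis mult.right_neutral mult_zero_right)

lemma deriv_zero: "D 0 = 0"
  using deriv_add[of 0 0] by (metis add_cancel_right_right add_0)

lemma deriv_minus: "D (- p) = - D p"
  using deriv_add[of p "- p"] deriv_zero by (simp add: eq_neg_iff_add_eq_0 add.commute)

lemma deriv_diff: "D (p - q) = D p - D q"
  using deriv_add[of p "- q"] deriv_minus[of q] by simp

lemma deriv_power: "D (p ^ j) = of_nat j * p ^ (j - 1) * D p"
proof (induction j)
  case (Suc j)
  then show ?case
    by (cases j) (simp_all add: deriv_mult algebra_simps)
qed (simp add: deriv_one)

lemmas deriv_rules = deriv_add deriv_mult deriv_diff deriv_minus deriv_power deriv_const
  deriv_one deriv_zero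

lemma funpow_deriv_zero: "(D ^^ j) 0 = 0"
  by (induction j) (simp_all add: deriv_zero)

lemma funpow_deriv_add: "(D ^^ j) (p + q) = (D ^^ j) p + (D ^^ j) q"
  by (induction j) (simp_all add: deriv_add)

lemma funpow_deriv_mult_kernel: "D c = 0 \<Longrightarrow> (D ^^ j) (c * p) = c * (D ^^ j) p"
  by (induction j) (simp_all add: deriv_mult)

lemma funpow_deriv_vanish_mono: "(D ^^ i) p = 0 \<Longrightarrow> i \<le> j \<Longrightarrow> (D ^^ j) p = 0"
  using funpow_deriv_zero by (metis comp_apply funpow_add le_add_diff_inverse2)

text \<open>Induction on the total exponent: in \<open>p * D q + q * D p\<close> one of the two
  exponents has dropped by one, which replaces the binomial Leibniz formula.\<close>

lemma funpow_deriv_mult_vanish: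
  "(D ^^ a) p = 0 \<Longrightarrow> (D ^^ b) q = 0 \<Longrightarrow> (D ^^ (a + b)) (p * q) = 0"
proof (induction "a + b" arbitrary: a b p q)
  case 0
  then show ?case by simp
next
  case (Suc s)
  show ?case
  proof (cases "a = 0 \<or> b = 0")
    case True
    then show ?thesis using Suc.prems funpow_deriv_zero by auto
  next
    case False
    then obtain a' b' where ab: "a = Suc a'" "b = Suc b'"
      by (metis not0_implies_Suc)
    have s: "s = a' + b" "s = a + b'"
      using Suc.hyps(2) ab by auto
    have "(D ^^ a') (D p) = 0" "(D ^^ b') (D q) = 0"
      using Suc.prems ab by (simp_all add: funpow_swap1)
    then have "(D ^^ s) (D p * q) = 0" "(D ^^ s) (p * D q) = 0"
      using Suc.hyps(1)[OF s(1)] Suc.hyps(1)[OF s(2)] Suc.prems s by metis+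
    then have "(D ^^ s) (D (p * q)) = 0"
      by (simp only: deriv_mult funpow_deriv_add mult.commute[of q] add_0)
    then show ?thesis
      by (simp flip: Suc.hyps(2) add: funpow_swap1)
  qed
qed

end

lemma Jac_derivation: "is_derivation (Jac f h)"
  by (rule is_derivationI)
    (simp_all add: Jac_def partials_derivation deriv_add deriv_mult deriv_const algebra_simps)

section \<open>Subalgebras, substitution and coordinate systems\<close>

definition is_subalg :: "'k::field poly3 set \<Rightarrow> bool" where
  "is_subalg A \<longleftrightarrow> (\<forall>a. constB a \<in> A) \<and> (\<forall>p\<in>A. \<forall>q\<in>A. p + q \<in> A \<and> p * q \<in> A)"

lemma subalg_add: "is_subalg A \<Longrightarrow> p \<in> A \<Longrightarrow> q \<in> A \<Longrightarrow> p + q \<in> A"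
  and subalg_mult: "is_subalg A \<Longrightarrow> p \<in> A \<Longrightarrow> q \<in> A \<Longrightarrow> p * q \<in> A"
  and subalg_const: "is_subalg A \<Longrightarrow> constB a \<in> A"
  by (auto simp: is_subalg_def)

lemma subalg_zero: "is_subalg A \<Longrightarrow> 0 \<in> A"
  and subalg_one: "is_subalg A \<Longrightarrow> 1 \<in> A"
  using subalg_const constB_simps(1,2) by metis+

lemma subalg_uminus:
  fixes A :: "'a::field poly3 set"
  assumes "is_subalg A" "p \<in> A"
  shows "- p \<in> A"
proof -
  have "constB (- 1) = - (1 :: 'a poly3)"
    by (simp add: constB_def one_pCons)
  then have "- p = constB (- 1) * p" by simp
  then show ?thesis
    using assms subalg_mult subalg_const by metis
qed

lemma subalg_diff: "is_subalg A \<Longrightarrow> p \<in> A \<Longrightarrow> q \<in> A \<Longrightarrow> p - q \<in> A"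
  using subalg_add[of A p "- q"] subalg_uminus[of A q] by simp

lemma subalg_power: "is_subalg A \<Longrightarrow> p \<in> A \<Longrightarrow> p ^ j \<in> A"
  by (induction j) (auto intro: subalg_one subalg_mult)

lemma subalg_sum: "is_subalg A \<Longrightarrow> (\<And>i. i \<in> I \<Longrightarrow> g i \<in> A) \<Longrightarrow> sum g I \<in> A"
  by (induction I rule: infinite_finite_induct) (auto intro: subalg_zero subalg_add)

lemma subalg_of_nat: "is_subalg A \<Longrightarrow> of_nat j \<in> A"
  by (induction j) (auto intro: subalg_zero subalg_one subalg_add)

lemmas subalg_intros = subalg_add subalg_mult subalg_const subalg_uminus subalg_diff subalg_power
  subalg_sum subalg_of_nat subalg_one subalg_zero

lemma subalg_alg_gen: "is_subalg (alg_gen S)"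
  by (auto simp: is_subalg_def intro: alg_gen.intros)

lemma alg_gen_least:
  assumes "is_subalg A" "S \<subseteq> A"
  shows "alg_gen S \<subseteq> A"
proof
  fix p assume "p \<in> alg_gen S"
  then show "p \<in> A"
    by induction (use assms in \<open>auto intro: subalg_intros\<close>)
qed

lemma subalg_kernel: "is_derivation D \<Longrightarrow> is_subalg {p. D p = 0}"
  by (auto simp: is_subalg_def deriv_const deriv_add deriv_mult)

text \<open>This handles one layer of nested polynomials; iterating it covers \<open>eval2\<close>
  and \<open>subst3\<close>.\<close>

lemma subalg_poly_eval:
  assumes "is_subalg A" "a \<in> A" "\<And>c. c \<in> set (coeffs p) \<Longrightarrow> \<phi> c \<in> A" "\<phi> 0 = 0"
  shows "poly (map_poly \<phi> p) a \<in> A"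
  using assms(3)
proof (induction p)
  case 0
  then show ?case using assms by (simp add: subalg_zero)
next
  case (pCons c p)
  then have "\<phi> c + a * poly (map_poly \<phi> p) a \<in> A"
    using assms by (intro subalg_add subalg_mult) auto
  with pCons.hyps assms show ?case by (simp add: map_poly_pCons)
qed

lemma subalg_eval1: "is_subalg A \<Longrightarrow> a \<in> A \<Longrightarrow> poly (map_poly constB p) a \<in> A"
  by (rule subalg_poly_eval) (auto intro: subalg_const simp: constB_simps)

lemma subalg_eval2: "is_subalg A \<Longrightarrow> a \<in> A \<Longrightarrow> b \<in> A \<Longrightarrow> eval2 F a b \<in> A"
  unfolding eval2_def by (rule subalg_poly_eval) (auto intro: subalg_eval1)

lemma subalg_subst3:
  "is_subalg A \<Longrightarrow> g1 \<in> A \<Longrightarrow> g2 \<in> A \<Longrightarrow> g3 \<in> A \<Longrightarrow> subst3 g1 g2 g3 p \<in> A"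
  unfolding subst3_def
  by (rule subalg_poly_eval, simp, simp, rule subalg_poly_eval) (auto intro: subalg_eval1)

lemma subst3_variables: "subst3 varX varY varZ p = p"
proof -
  have 1: "poly (map_poly constB u) varX = [:[:u:]:]" for u :: "'a poly"
    by (induction u) (simp_all add: map_poly_pCons constB_simps constB_def varX_def)
  have 2: "poly (map_poly (\<lambda>u. [:[:u:]:]) v) varY = [:v:]" for v :: "'a poly poly"
    by (induction v) (simp_all add: map_poly_pCons varY_def flip: one_pCons)
  have 3: "poly (map_poly (\<lambda>v. [:v:]) w) varZ = w" for w :: "'a poly3"
    by (induction w) (simp_all add: map_poly_pCons varZ_def flip: one_pCons)
  show ?thesis by (simp add: subst3_def 1 2 3)
qed

lemma coord_system_variables: "coord_system varX varY varZ"
  unfolding coord_system_def by (metis subst3_variables surjI)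

lemma alg_gen_coord_system:
  assumes "coord_system g1 g2 g3"
  shows "p \<in> alg_gen {g1, g2, g3}"
proof -
  obtain q where "p = subst3 g1 g2 g3 q"
    using assms unfolding coord_system_def by (metis surjD)
  then show ?thesis
    by (auto intro: subalg_subst3 subalg_alg_gen alg_gen.gen)
qed

text \<open>This reduces claims about all of B to the three variables, once the elements satisfying
  the claim are known to form a subalgebra.\<close>

lemma subalg_UNIV_if_variables:
  "is_subalg A \<Longrightarrow> varX \<in> A \<Longrightarrow> varY \<in> A \<Longrightarrow> varZ \<in> A \<Longrightarrow> p \<in> A"
  using alg_gen_coord_system[OF coord_system_variables] alg_gen_least[of A "{varX, varY, varZ}"]
  by blast

section \<open>Polynomial expressions in generators, and the Jacobian of a coordinate system\<close>

text \<open>The coefficients are the formal partial derivatives of a polynomial expression for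
  \<open>u\<close>. They are chosen before \<open>D\<close>, so the same ones serve
  \<open>dX\<close>, \<open>dY\<close> and \<open>dZ\<close>, and they stay in the generated
  algebra.\<close>

lemma chain_rule_alg_gen:
  assumes "u \<in> alg_gen {a, b, c}"
  shows "\<exists>\<alpha>\<in>alg_gen {a, b, c}. \<exists>\<beta>\<in>alg_gen {a, b, c}. \<exists>\<gamma>\<in>alg_gen {a, b, c}.
    \<forall>D. is_derivation D \<longrightarrow> D u = \<alpha> * D a + \<beta> * D b + \<gamma> * D c"
  using assms
proof induction
  case (const a)
  show ?case
    by (intro bexI[of _ 0]) (auto simp: deriv_const intro: subalg_zero subalg_alg_gen)
next
  case (gen s)
  have mem: "0 \<in> alg_gen {a, b, c}" "1 \<in> alg_gen {a, b, c}"
    by (auto intro: subalg_zero subalg_one subalg_alg_gen)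
  from gen consider "s = a" | "s = b" | "s = c" by auto
  then show ?case
  proof cases
    case 1
    show ?thesis by (rule bexI[of _ 1], rule bexI[of _ 0], rule bexI[of _ 0]) (use 1 mem in auto)
  next
    case 2
    show ?thesis by (rule bexI[of _ 0], rule bexI[of _ 1], rule bexI[of _ 0]) (use 2 mem in auto)
  next
    case 3
    show ?thesis by (rule bexI[of _ 0], rule bexI[of _ 0], rule bexI[of _ 1]) (use 3 mem in auto)
  qed
next
  case (add p q)
  let ?A = "alg_gen {a, b, c}"
  from add.IH(1) obtain \<alpha> \<beta> \<gamma> where p: "\<alpha> \<in> ?A" "\<beta> \<in> ?A" "\<gamma> \<in> ?A"
    and Dp: "\<forall>D. is_derivation D \<longrightarrow> D p = \<alpha> * D a + \<beta> * D b + \<gamma> * D c"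
    by blast
  from add.IH(2) obtain \<alpha>' \<beta>' \<gamma>' where q: "\<alpha>' \<in> ?A" "\<beta>' \<in> ?A" "\<gamma>' \<in> ?A"
    and Dq: "\<forall>D. is_derivation D \<longrightarrow> D q = \<alpha>' * D a + \<beta>' * D b + \<gamma>' * D c"
    by blast
  have "D (p + q) = (\<alpha> + \<alpha>') * D a + (\<beta> + \<beta>') * D b + (\<gamma> + \<gamma>') * D c" if D: "is_derivation D" for D
  proof -
    have "D p = \<alpha> * D a + \<beta> * D b + \<gamma> * D c" "D q = \<alpha>' * D a + \<beta>' * D b + \<gamma>' * D c"
      using Dp Dq D by blast+
    then show ?thesis by (simp add: deriv_add[OF D] algebra_simps)
  qed
  moreover have "\<alpha> + \<alpha>' \<in> ?A" "\<beta> + \<beta>' \<in> ?A" "\<gamma> + \<gamma>' \<in> ?A"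
    using p q by (simp_all add: alg_gen.add alg_gen.mult)
  ultimately show ?case by blast
next
  case (mult p q)
  let ?A = "alg_gen {a, b, c}"
  from mult.IH(1) obtain \<alpha> \<beta> \<gamma> where p: "\<alpha> \<in> ?A" "\<beta> \<in> ?A" "\<gamma> \<in> ?A"
    and Dp: "\<forall>D. is_derivation D \<longrightarrow> D p = \<alpha> * D a + \<beta> * D b + \<gamma> * D c"
    by blast
  from mult.IH(2) obtain \<alpha>' \<beta>' \<gamma>' where q: "\<alpha>' \<in> ?A" "\<beta>' \<in> ?A" "\<gamma>' \<in> ?A"
    and Dq: "\<forall>D. is_derivation D \<longrightarrow> D q = \<alpha>' * D a + \<beta>' * D b + \<gamma>' * D c"
    by blast
  have "D (p * q) = (p * \<alpha>' + q * \<alpha>) * D a + (p * \<beta>' + q * \<beta>) * D b + (p * \<gamma>' + q * \<gamma>) * D c" if D: "is_derivation D" for D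
  proof -
    have "D p = \<alpha> * D a + \<beta> * D b + \<gamma> * D c" "D q = \<alpha>' * D a + \<beta>' * D b + \<gamma>' * D c"
      using Dp Dq D by blast+
    then show ?thesis by (simp add: deriv_mult[OF D] algebra_simps)
  qed
  moreover have "p * \<alpha>' + q * \<alpha> \<in> ?A" "p * \<beta>' + q * \<beta> \<in> ?A" "p * \<gamma>' + q * \<gamma> \<in> ?A"
    using p q mult.hyps by (simp_all add: alg_gen.add alg_gen.mult)
  ultimately show ?case by blast
qed

text \<open>Collect the monomials free of \<open>b\<close>. The polynomial \<open>c\<close> has
  coefficients in k, so it can be tested by evaluation at points where \<open>b\<close>
  vanishes.\<close>

lemma alg_gen_split:
  assumes "u \<in> alg_gen {a, b}"
  shows "\<exists>c. \<exists>v\<in>alg_gen {a, b}. u = poly (map_poly constB c) a + b * v"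
  using assms
proof induction
  case (const c)
  have "constB c = poly (map_poly constB [:c:]) a + b * 0"
    by (simp add: map_poly_pCons constB_simps)
  then show ?case by (metis subalg_zero subalg_alg_gen)
next
  case (gen s)
  have mem: "0 \<in> alg_gen {a, b}" "1 \<in> alg_gen {a, b}"
    by (simp_all add: subalg_zero subalg_one subalg_alg_gen)
  from gen consider "s = a" | "s = b" by auto
  then show ?case
  proof cases
    case 1
    show ?thesis
      by (rule exI[of _ "[:0, 1:]"], rule bexI[OF _ mem(1)])
        (simp add: 1 map_poly_pCons constB_simps)
  next
    case 2
    show ?thesis
      by (rule exI[of _ 0], rule bexI[OF _ mem(2)]) (simp add: 2)
  qed
next
  case (add p q)
  then obtain c v c' v' where *: "v \<in> alg_gen {a, b}" "v' \<in> alg_gen {a, b}"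
    "p = poly (map_poly constB c) a + b * v" "q = poly (map_poly constB c') a + b * v'"
    by metis
  then have "p + q = poly (map_poly constB (c + c')) a + b * (v + v')"
    by (simp add: map_poly_additive[OF constB_simps(1,3)] algebra_simps)
  with * show ?case by (metis alg_gen.add)
next
  case (mult p q)
  then obtain c v c' v' where *: "v \<in> alg_gen {a, b}" "v' \<in> alg_gen {a, b}"
    "p = poly (map_poly constB c) a + b * v" "q = poly (map_poly constB c') a + b * v'"
    by metis
  have hom: "poly (map_poly constB (c * c')) a = poly (map_poly constB c) a * poly (map_poly constB c') a"
  proof (induction c)
    case (pCons d c)
    have "map_poly constB (smult d c') = smult (constB d) (map_poly constB c')"
      by (rule poly_eqI) (simp add: coeff_map_poly constB_simps)
    with pCons show ?case
      by (simp add: map_poly_pCons constB_simps map_poly_additive[OF constB_simps(1,3)] algebra_simps)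
  qed simp
  have "p * q = poly (map_poly constB (c * c')) a + b * (poly (map_poly constB c) a * v' + v * q)"
    unfolding hom by (simp add: * algebra_simps)
  moreover have "poly (map_poly constB c) a * v' + v * q \<in> alg_gen {a, b}"
    by (intro alg_gen.add alg_gen.mult subalg_eval1 subalg_alg_gen * mult.hyps) (simp add: alg_gen.gen)
  ultimately show ?case by blast
qed

lemma alg_gen_constant_term:
  assumes "u \<in> alg_gen {a, b}"
  shows "\<exists>c v w. u = constB c + a * v + b * w"
proof -
  obtain c v where "u = poly (map_poly constB c) a + b * v"
    using alg_gen_split[OF assms] by blast
  moreover obtain d c' where "c = pCons d c'" by (cases c) auto
  ultimately have "u = constB d + a * poly (map_poly constB c') a + b * v"
    by (simp add: map_poly_pCons constB_simps)
  then show ?thesis by blast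
qed

text \<open>Surjectivity makes x, y, z polynomials in the \<open>g1\<close>, \<open>g2\<close>,
  \<open>g3\<close>. By the chain rule the identity matrix is a product with the Jacobian matrix as
  a factor; take determinants.\<close>

lemma Jac_coord_system_unit:
  assumes "coord_system g1 g2 g3"
  shows "Jac g1 g2 g3 dvd 1"
proof -
  have ex: "\<exists>\<alpha> \<beta> \<gamma>. \<forall>D. is_derivation D \<longrightarrow> D u = \<alpha> * D g1 + \<beta> * D g2 + \<gamma> * D g3" for u
    using chain_rule_alg_gen[OF alg_gen_coord_system[OF assms]] by blast
  obtain a1 b1 c1 where 1: "\<And>D. is_derivation D \<Longrightarrow> D varX = a1 * D g1 + b1 * D g2 + c1 * D g3"
    using ex[of varX] by blast
  obtain a2 b2 c2 where 2: "\<And>D. is_derivation D \<Longrightarrow> D varY = a2 * D g1 + b2 * D g2 + c2 * D g3"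
    using ex[of varY] by blast
  obtain a3 b3 c3 where 3: "\<And>D. is_derivation D \<Longrightarrow> D varZ = a3 * D g1 + b3 * D g2 + c3 * D g3"
    using ex[of varZ] by blast
  have "1 = Jac varX varY varZ"
    by (simp add: Jac_def)
  also have "\<dots> = Jac g1 g2 g3 *
      (a1 * (b2 * c3 - c2 * b3) - b1 * (a2 * c3 - c2 * a3) + c1 * (a2 * b3 - b2 * a3))"
    unfolding Jac_def 1[OF dX_derivation] 1[OF dY_derivation] 1[OF dZ_derivation]
      2[OF dX_derivation] 2[OF dY_derivation] 2[OF dZ_derivation]
      3[OF dX_derivation] 3[OF dY_derivation] 3[OF dZ_derivation]
    by algebra
  finally show ?thesis by (rule dvdI)
qed

section \<open>Nilpotent elements and local slices\<close>

lemma subalg_nilpotent: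
  assumes "is_derivation D"
  shows "is_subalg {p. \<exists>j. (D ^^ j) p = 0}"
proof -
  note D = assms
  have "\<exists>j. (D ^^ j) (constB a) = 0" for a
    by (rule exI[of _ 1]) (simp add: deriv_const[OF D])
  moreover have "\<exists>j. (D ^^ j) (p + q) = 0" if "(D ^^ a) p = 0" "(D ^^ b) q = 0" for a b p q
    using funpow_deriv_vanish_mono[OF D that(1), of "a + b"] funpow_deriv_vanish_mono[OF D that(2), of "a + b"]
    by (intro exI[of _ "a + b"]) (simp add: funpow_deriv_add[OF D])
  moreover have "\<exists>j. (D ^^ j) (p * q) = 0" if "(D ^^ a) p = 0" "(D ^^ b) q = 0" for a b p q
    using funpow_deriv_mult_vanish[OF D that] by blast
  ultimately show ?thesis by (auto simp: is_subalg_def)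
qed

text \<open>On A[r] the derivation acts as \<open>D r\<close> times d/dr, and r is transcendental
  over A, so in characteristic zero a kernel element is a constant polynomial in r.\<close>

lemma kernel_in_extension_by_local_slice:
  fixes A :: "'k::field_char_0 poly3 set"
  assumes D: "is_derivation D" and A: "is_subalg A" "\<And>a. a \<in> A \<Longrightarrow> D a = 0"
    and r: "D (D r) = 0" "D r \<noteq> 0"
    and u: "u \<in> alg_gen (insert r A)" "D u = 0"
  shows "u \<in> A"
proof -
  \<comment> \<open>\<open>P\<close> is the polynomial ring A[T] inside B[T]; its values at
    \<open>r\<close> form A[r].\<close>
  define P where "P = {p :: 'k poly3 poly. \<forall>i. coeff p i \<in> A}"
  have "is_subalg {poly p r |p. p \<in> P}" (is "is_subalg ?C")
    unfolding is_subalg_def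
  proof (intro conjI allI ballI)
    fix a show "constB a \<in> ?C"
      using A(1) by (auto intro!: exI[of _ "[:constB a:]"] simp: P_def coeff_pCons subalg_const subalg_zero split: nat.split)
  next
    fix x y assume "x \<in> ?C" "y \<in> ?C"
    then obtain p q where *: "p \<in> P" "q \<in> P" "x = poly p r" "y = poly q r" by auto
    have "p + q \<in> P" using * A(1) by (auto simp: P_def intro: subalg_add)
    then show "x + y \<in> ?C" using * by (metis (mono_tags, lifting) mem_Collect_eq poly_add)
    have "p * q \<in> P" using * A(1) by (auto simp: P_def coeff_mult intro!: subalg_sum subalg_mult)
    then show "x * y \<in> ?C" using * by (metis (mono_tags, lifting) mem_Collect_eq poly_mult)
  qed
  moreover have "insert r A \<subseteq> ?C"
  proof -
    have "r \<in> ?C"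
      using A(1) by (auto intro!: exI[of _ "[:0, 1:]"] simp: P_def coeff_pCons subalg_one subalg_zero split: nat.split)
    moreover have "a \<in> ?C" if "a \<in> A" for a
      using A(1) that by (auto intro!: exI[of _ "[:a:]"] simp: P_def coeff_pCons subalg_zero split: nat.split)
    ultimately show ?thesis by blast
  qed
  ultimately obtain p where p: "p \<in> P" "u = poly p r"
    using alg_gen_least u(1) by blast
  have D_poly: "D (poly q r) = poly (pderiv q) r * D r" if "q \<in> P" for q
    using that
  proof (induction q)
    case 0
    then show ?case by (simp add: deriv_zero[OF D])
  next
    case (pCons a q)
    have *: "coeff q i \<in> A" for i
      using pCons.prems by (auto simp: P_def dest: spec[of _ "Suc i"])
    have "a \<in> A" using pCons.prems by (auto simp: P_def dest: spec[of _ 0])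
    with * pCons.IH show ?case
      by (simp add: P_def deriv_add[OF D] deriv_mult[OF D] A(2) pderiv_pCons algebra_simps)
  qed
  have pderiv_P: "pderiv q \<in> P" if "q \<in> P" for q
    using that A(1) unfolding P_def by (auto simp: coeff_pderiv intro!: subalg_mult subalg_add subalg_of_nat subalg_one)
  \<comment> \<open>Transcendence of \<open>r\<close>: applying \<open>D\<close> to a relation and
    cancelling \<open>D r\<close> gives a relation of smaller degree, namely the derivative.\<close>
  have no_root: "q = 0" if "q \<in> P" "poly q r = 0" for q
    using that
  proof (induction "degree q" arbitrary: q rule: less_induct)
    case less
    show ?case
    proof (cases "degree q = 0")
      case True
      then obtain a where "q = [:a:]" by (metis degree_eq_zeroE)
      with less.prems show ?thesis by simp
    next
      case False
      have "poly (pderiv q) r = 0"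
        using D_poly[OF less.prems(1)] less.prems(2) r(2) by (simp add: deriv_zero[OF D])
      then have "pderiv q = 0"
        using less.hyps[of "pderiv q"] False pderiv_P less.prems by (simp add: degree_pderiv)
      then show ?thesis using False by (simp add: pderiv_eq_0_iff)
    qed
  qed
  have "poly (pderiv p) r = 0"
    using D_poly[OF p(1)] u(2) p(2) r(2) by simp
  then have "pderiv p = 0" using no_root pderiv_P p(1) by blast
  then obtain a where "p = [:a:]" by (metis degree_eq_zeroE pderiv_eq_0_iff)
  with p show ?thesis by (auto simp: P_def dest: spec[of _ 0])
qed

section \<open>Evaluation at points\<close>

definition ev :: "'k::field \<Rightarrow> 'k \<Rightarrow> 'k \<Rightarrow> 'k poly3 \<Rightarrow> 'k" where
  "ev a b c u = poly (poly (poly u [:[:c:]:]) [:b:]) a"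

lemma ev_simps [simp]:
  "ev a b c (p + q) = ev a b c p + ev a b c q" "ev a b c (p - q) = ev a b c p - ev a b c q"
  "ev a b c (p * q) = ev a b c p * ev a b c q" "ev a b c (p ^ j) = ev a b c p ^ j"
  "ev a b c (- p) = - ev a b c p"
  "ev a b c 0 = 0" "ev a b c 1 = 1" "ev a b c (constB d) = d" "ev a b c (of_nat j) = of_nat j"
  "ev a b c varX = a" "ev a b c varY = b" "ev a b c varZ = c"
  by (simp_all add: ev_def constB_def varX_def varY_def varZ_def)

lemma ev_eval1: "ev a b c (poly (map_poly constB p) u) = poly p (ev a b c u)"
  by (induction p) (simp_all add: map_poly_pCons constB_simps)

lemma ev_eval2: "ev a b c (eval2 F u v) = poly (poly F [:ev a b c v:]) (ev a b c u)"
  unfolding eval2_def by (induction F) (simp_all add: map_poly_pCons ev_eval1)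

section \<open>The derivation E(m,n,F)\<close>

text \<open>The quotient h is described by its product with x, which determines it because B is a
  domain. As t2 is the outer variable, \<open>poly F 0\<close> is F(t1,0), called p below.\<close>

locale rank3_data =
  fixes F :: "'k::field_char_0 poly poly" and m n :: nat and f r h :: "'k poly3"
  assumes m: "m \<ge> 2" and n: "n \<ge> 1"
    and F: "poly F 0 \<notin> range (\<lambda>c. [:c:])"
    and f_def: "f = varX * varZ - varY ^ m"
    and r_def: "r = varX * eval2 F varX f + varY * f ^ n"
    and h_def: "varX * h = f ^ (m * n + 1) + r ^ m"
begin

abbreviation "E \<equiv> Jac f h"
abbreviation "G \<equiv> eval2 F varX f"
abbreviation "w \<equiv> varY * f ^ n"
abbreviation "A \<equiv> alg_gen {f, h}"

section \<open>Explicit form of h and its values on the axis y = z = 0\<close>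

lemma varX_nonzero: "varX \<noteq> (0 :: 'k poly3)"
  by (simp add: varX_def)

text \<open>The cofactor in \<open>w ^ m - r ^ m = (w - r) * S\<close>, where \<open>w - r\<close>
  is \<open>- varX * G\<close>.\<close>

definition S where "S = (\<Sum>i<m. r ^ (m - Suc i) * w ^ i)"

text \<open>Carries out the division by x: modulo x, r is w, and the remaining terms
  \<open>f ^ (m * n + 1) + w ^ m\<close> combine to \<open>(f + varY ^ m) * f ^ (m * n)\<close>,
  with first factor xz.\<close>

lemma h_eq: "h = varZ * f ^ (m * n) + G * S"
proof -
  have "w ^ m - r ^ m = (w - r) * S"
    unfolding S_def by (rule power_diff_sumr2)
  then have "r ^ m = w ^ m + varX * G * S"
    by (simp add: r_def algebra_simps)
  moreover have "w ^ m = varY ^ m * f ^ (m * n)"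
    by (simp add: power_mult_distrib power_mult[symmetric] mult.commute)
  ultimately have "varX * h = (f + varY ^ m) * f ^ (m * n) + varX * G * S"
    using h_def by (simp add: algebra_simps)
  also have "f + varY ^ m = varX * varZ" by (simp add: f_def)
  finally have "varX * h = varX * (varZ * f ^ (m * n) + G * S)" by (simp add: algebra_simps)
  then show ?thesis using varX_nonzero by simp
qed

text \<open>On the lines considered later \<open>w\<close> vanishes, so only the summand with index
  0 contributes there.\<close>

lemma S_split: "\<exists>T. S = r ^ (m - 1) + w * T"
proof -
  obtain k where k: "m = Suc k" using m by (cases m) auto
  have "S = r ^ k + w * (\<Sum>i<k. r ^ (k - Suc i) * w ^ i)"
    unfolding S_def unfolding k sum.lessThan_Suc_shift by (simp add: sum_distrib_left mult.left_commute mult.assoc)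
  then show ?thesis using k by auto
qed

lemma p_nonconst: "degree (poly F 0) > 0"
  using F by (metis degree_eq_zeroE gr0I rangeI)

lemma ev_axis:
  "ev s 0 0 f = 0" "ev s 0 0 r = s * poly (poly F 0) s"
  "ev s 0 0 h = s ^ (m - 1) * poly (poly F 0) s ^ m"
proof -
  show f0: "ev s 0 0 f = 0" using m by (simp add: f_def)
  show r0: "ev s 0 0 r = s * poly (poly F 0) s" by (simp add: r_def ev_eval2 f0)
  obtain T where "S = r ^ (m - 1) + w * T" using S_split by blast
  then have "ev s 0 0 h = poly (poly F 0) s * (s * poly (poly F 0) s) ^ (m - 1)"
    using m by (simp add: h_eq ev_eval2 f0 r0)
  also have "\<dots> = s ^ (m - 1) * poly (poly F 0) s ^ Suc (m - 1)"
    by (simp add: power_mult_distrib algebra_simps)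
  finally show "ev s 0 0 h = s ^ (m - 1) * poly (poly F 0) s ^ m" using m by simp
qed

lemma nonzero: "f \<noteq> 0" "r \<noteq> 0" "h \<noteq> 0"
proof -
  have "ev 0 1 0 f \<noteq> 0" by (simp add: f_def)
  then show "f \<noteq> 0" by force
  \<comment> \<open>The field is infinite, so some s has s p(s) nonzero; at (s,0,0) both r and h are
    then nonzero.\<close>
  have "[:0, 1:] * poly F 0 \<noteq> 0" using p_nonconst by auto
  then obtain s where s: "poly ([:0, 1:] * poly F 0) s \<noteq> 0"
    using poly_all_0_iff_0 by blast
  then have "ev s 0 0 r \<noteq> 0" "ev s 0 0 h \<noteq> 0" by (auto simp: ev_axis)
  then show "r \<noteq> 0" "h \<noteq> 0" by force+
qed

section \<open>Values of E and local nilpotency\<close>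

lemma E_f: "E f = 0" and E_h: "E h = 0"
  by (simp_all add: Jac_def algebra_simps)

text \<open>Swapping rows gives Jac(f,h,x) = -Jac(f,x,h). The derivation Jac(f,x,.) kills f and x
  and sends y to x, so its value at h follows from the relation for xh after cancelling x.\<close>

lemma E_x: "E varX = - (of_nat m * r ^ (m - 1) * f ^ n)"
proof -
  let ?D = "Jac f varX"
  note D = Jac_derivation[of f varX]
  have f: "?D f = 0" and x: "?D varX = 0"
    by (simp_all add: Jac_def algebra_simps)
  have "dZ f = varX"
    by (simp add: f_def deriv_rules[OF dZ_derivation])
  then have "?D varY = varX" by (simp add: Jac_def)
  moreover have "?D G = 0"
    using subalg_eval2[OF subalg_kernel[OF D], of varX f F] f x by simp
  ultimately have "?D r = varX * f ^ n"
    by (simp add: r_def deriv_rules[OF D] f x algebra_simps)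
  moreover have "?D (varX * h) = of_nat m * r ^ (m - 1) * ?D r"
    unfolding h_def by (simp add: deriv_rules[OF D] f)
  ultimately have "varX * ?D h = varX * (of_nat m * r ^ (m - 1) * f ^ n)"
    by (simp add: deriv_rules[OF D] x algebra_simps)
  then have "?D h = of_nat m * r ^ (m - 1) * f ^ n" using varX_nonzero by simp
  moreover have "E varX = - ?D h" unfolding Jac_def by algebra
  ultimately show ?thesis by simp
qed

lemma E_r: "E r = - (h * f ^ n)"
proof -
  note D = Jac_derivation[of f h]
  have "E (varX * h) = of_nat m * r ^ (m - 1) * E r"
    unfolding h_def by (simp add: deriv_rules[OF D] E_f)
  then have "of_nat m * r ^ (m - 1) * E r = of_nat m * r ^ (m - 1) * - (h * f ^ n)"
    by (simp add: deriv_rules[OF D] E_h E_x algebra_simps)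
  moreover have "of_nat m * r ^ (m - 1) \<noteq> 0" using m nonzero by simp
  ultimately show ?thesis using mult_cancel_left by blast
qed

lemma kernel_A: "A \<subseteq> {p. E p = 0}"
  by (rule alg_gen_least) (auto simp: subalg_kernel Jac_derivation E_f E_h)

lemma locally_nilpotent_E: "locally_nilpotent E"
proof -
  note D = Jac_derivation[of f h]
  define N where "N = {p. \<exists>j. (E ^^ j) p = 0}"
  have N: "is_subalg N" unfolding N_def by (rule subalg_nilpotent[OF D])
  \<comment> \<open>\<open>lift\<close> and \<open>cancel\<close> carry nilpotency along the chain
    f, h, r, x, y, z: \<open>E r\<close> and \<open>E varX\<close> involve only earlier elements,
    while y and z are reached after multiplication by a power of the kernel element f.\<close>
  have lift: "p \<in> N" if "E p \<in> N" for p
    using that unfolding N_def by (auto simp: funpow_swap1 intro: exI[of _ "Suc _"])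
  have cancel: "p \<in> N" if "c * p \<in> N" "E c = 0" "c \<noteq> 0" for c p
    using that unfolding N_def by (auto simp: funpow_deriv_mult_kernel[OF D])
  have zero: "p \<in> N" if "E p = 0" for p
    using that lift subalg_zero[OF N] by simp
  have fh: "f \<in> N" "h \<in> N" using zero E_f E_h by auto
  have r: "r \<in> N"
    by (rule lift) (auto simp: E_r intro!: subalg_intros N fh)
  have x: "varX \<in> N"
    by (rule lift) (auto simp: E_x intro!: subalg_intros N fh r)
  have G: "G \<in> N" by (intro subalg_eval2 N x fh)
  have y: "varY \<in> N"
  proof (rule cancel)
    have "f ^ n * varY = r - varX * G" by (simp add: r_def)
    then show "f ^ n * varY \<in> N" by (auto intro: subalg_intros N r x G)
  qed (simp_all add: nonzero deriv_rules[OF D] E_f)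
  have S: "S \<in> N" unfolding S_def by (intro subalg_intros N r y fh)
  have z: "varZ \<in> N"
  proof (rule cancel)
    have "f ^ (m * n) * varZ = h - G * S" by (subst h_eq) simp
    then show "f ^ (m * n) * varZ \<in> N" by (auto intro: subalg_intros N fh G S)
  qed (simp_all add: nonzero deriv_rules[OF D] E_f)
  show ?thesis
    using subalg_UNIV_if_variables[OF N x y z] by (auto simp: locally_nilpotent_def N_def)
qed

section \<open>The kernel of E\<close>

text \<open>With f and h inverted, the relation for xh gives x, the definition of r then gives y,
  and \<open>h_eq\<close> gives z. The set \<open>L\<close> below plays the role of the
  localisation, intersected with B.\<close>

lemma localised_slice:
  "\<exists>j. (f * h) ^ j * p \<in> alg_gen {f, h, r}"
proof -
  let ?C = "alg_gen {f, h, r}"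
  note C = subalg_alg_gen[of "{f, h, r}"]
  have fhr: "f \<in> ?C" "h \<in> ?C" "r \<in> ?C" by (auto intro: alg_gen.gen)
  define L where "L = {p. \<exists>j. (f * h) ^ j * p \<in> ?C}"
  have mono: "(f * h) ^ j * p \<in> ?C" if "(f * h) ^ i * p \<in> ?C" "i \<le> j" for i j p
  proof -
    have "(f * h) ^ (j - i) * ((f * h) ^ i * p) \<in> ?C"
      by (rule alg_gen.mult[OF _ that(1)]) (intro subalg_intros C fhr)
    then show ?thesis using that by (simp add: mult.assoc[symmetric] power_add[symmetric])
  qed
  have CL: "?C \<subseteq> L" unfolding L_def by (auto intro: exI[of _ 0])
  have L: "is_subalg L"
    unfolding is_subalg_def
  proof (intro conjI allI ballI)
    show "constB a \<in> L" for a using CL alg_gen.const by blast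
    fix p q assume "p \<in> L" "q \<in> L"
    then obtain i j where ij: "(f * h) ^ i * p \<in> ?C" "(f * h) ^ j * q \<in> ?C"
      by (auto simp: L_def)
    then have "(f * h) ^ (i + j) * p + (f * h) ^ (i + j) * q \<in> ?C"
      using mono[OF ij(1), of "i + j"] mono[OF ij(2), of "i + j"] by (simp add: alg_gen.add)
    then show "p + q \<in> L" unfolding L_def by (auto simp: algebra_simps)
    have "((f * h) ^ i * p) * ((f * h) ^ j * q) \<in> ?C" by (intro alg_gen.mult ij)
    then have "(f * h) ^ (i + j) * (p * q) \<in> ?C" by (simp add: power_add mult_ac)
    then show "p * q \<in> L" unfolding L_def by blast
  qed
  \<comment> \<open>Multiplying by \<open>f ^ j * h ^ i\<close> balances the two exponents to a
    power of fh.\<close>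
  have cancel: "p \<in> L" if "f ^ i * h ^ j * p \<in> L" for i j p
  proof -
    from that obtain k where "(f * h) ^ k * (f ^ i * h ^ j * p) \<in> ?C" unfolding L_def by blast
    then have "f ^ j * h ^ i * ((f * h) ^ k * (f ^ i * h ^ j * p)) \<in> ?C"
      by (rule alg_gen.mult[rotated]) (intro subalg_intros C fhr)
    moreover have "f ^ j * h ^ i * ((f * h) ^ k * (f ^ i * h ^ j * p)) = (f * h) ^ (k + i + j) * p"
      by (simp add: power_add power_mult_distrib mult_ac)
    ultimately have "(f * h) ^ (k + i + j) * p \<in> ?C" by simp
    then show ?thesis unfolding L_def by blast
  qed
  have fhr': "f \<in> L" "h \<in> L" "r \<in> L" using CL fhr by auto
  have x: "varX \<in> L"
  proof (rule cancel[of 0 1])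
    have "f ^ 0 * h ^ 1 * varX = f ^ (m * n + 1) + r ^ m"
      using h_def by (simp add: mult.commute)
    also have "\<dots> \<in> L" by (intro subalg_intros L fhr')
    finally show "f ^ 0 * h ^ 1 * varX \<in> L" .
  qed
  have G: "G \<in> L" by (intro subalg_eval2 L x fhr')
  have y: "varY \<in> L"
  proof (rule cancel[of n 0])
    have "f ^ n * h ^ 0 * varY = r - varX * G" by (simp add: r_def)
    also have "\<dots> \<in> L" by (intro subalg_intros L fhr' x G)
    finally show "f ^ n * h ^ 0 * varY \<in> L" .
  qed
  have S: "S \<in> L" unfolding S_def by (intro subalg_intros L fhr' y)
  have z: "varZ \<in> L"
  proof (rule cancel[of "m * n" 0])
    have "f ^ (m * n) * h ^ 0 * varZ = h - G * S" by (subst h_eq) simp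
    also have "\<dots> \<in> L" by (intro subalg_intros L fhr' G S)
    finally show "f ^ (m * n) * h ^ 0 * varZ \<in> L" .
  qed
  show ?thesis using subalg_UNIV_if_variables[OF L x y z] by (auto simp: L_def)
qed

text \<open>Split off the part c(h) free of f. On the axis y = z = 0, where f = 0, h restricts to
  the nonconstant polynomial \<open>q\<close>, so c(q) = 0 forces c = 0 and u = v.\<close>

lemma descent_f:
  assumes "f * u \<in> A"
  shows "u \<in> A"
proof -
  have A: "alg_gen {h, f} = A" by (simp add: insert_commute)
  obtain c v where v: "v \<in> A" "f * u = poly (map_poly constB c) h + f * v"
    using alg_gen_split[of "f * u" h f] assms unfolding A by blast
  define q where "q = [:0, 1:] ^ (m - 1) * poly F 0 ^ m"
  have "poly (pcompose c q) s = 0" for s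
  proof -
    have "ev s 0 0 (f * u) = ev s 0 0 (poly (map_poly constB c) h + f * v)" using v by simp
    then show ?thesis by (simp add: ev_eval1 ev_axis poly_pcompose q_def)
  qed
  then have "pcompose c q = 0" using poly_all_0_iff_0 by blast
  moreover have "degree q > 0"
    using p_nonconst m unfolding q_def
    by (subst degree_mult_eq) (auto simp: degree_power_eq)
  ultimately have "c = 0" by (rule pcompose_eq_0)
  with v nonzero show ?thesis by simp
qed

text \<open>The equation h = 0 forces f^(mn+1) = -r^m, which is solved by f = -t^m and
  r = (-1)^n t^(mn+1); with x = 1 these values determine y and z.\<close>

lemma curve_in_h_zero:
  assumes "t \<noteq> 0"
  shows "\<exists>b c. ev 1 b c f = - (t ^ m) \<and> ev 1 b c h = 0"
proof -
  define f0 where "f0 = - (t ^ m)"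
  define r0 where "r0 = (- 1) ^ n * t ^ (m * n + 1)"
  define b where "b = (r0 - poly (poly F [:f0:]) 1) / f0 ^ n"
  define c where "c = f0 + b ^ m"
  have f: "ev 1 b c f = f0" by (simp add: f_def c_def)
  moreover have "ev 1 b c r = r0"
  proof -
    have "ev 1 b c r = poly (poly F [:f0:]) 1 + b * f0 ^ n"
      by (simp add: r_def ev_eval2 f)
    moreover have "f0 \<noteq> 0" using assms by (simp add: f0_def)
    ultimately show ?thesis by (simp add: b_def)
  qed
  moreover have "ev 1 b c (varX * h) = ev 1 b c f ^ (m * n + 1) + ev 1 b c r ^ m"
    by (simp add: h_def)
  ultimately have "ev 1 b c h = f0 ^ (m * n + 1) + r0 ^ m" by simp
  also have "f0 ^ (m * n + 1) = - ((- 1) ^ (m * n) * (t ^ m) ^ (m * n + 1))"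
    unfolding f0_def by (subst power_minus) simp
  also have "r0 ^ m = (- 1) ^ (m * n) * (t ^ m) ^ (m * n + 1)"
    unfolding r0_def by (simp only: power_mult_distrib power_mult[symmetric] mult.commute)
  finally show ?thesis using f f0_def by auto
qed

text \<open>The argument of \<open>descent_f\<close> with the roles exchanged: on the curve in h = 0
  the values of f are -t^m, the values of a nonconstant polynomial.\<close>

lemma descent_h:
  assumes "h * u \<in> A"
  shows "u \<in> A"
proof -
  obtain c v where v: "v \<in> A" "h * u = poly (map_poly constB c) f + h * v"
    using alg_gen_split[OF assms] by blast
  define q :: "'k poly" where "q = monom (- 1) m"
  \<comment> \<open>The factor t takes care of t = 0, where the curve supplies no point.\<close>
  have "poly ([:0, 1:] * pcompose c q) t = 0" for t
  proof (cases "t = 0")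
    case False
    then obtain b d where bd: "ev 1 b d f = - (t ^ m)" "ev 1 b d h = 0"
      using curve_in_h_zero by blast
    have "ev 1 b d (h * u) = ev 1 b d (poly (map_poly constB c) f + h * v)" using v by simp
    then show ?thesis by (simp add: ev_eval1 bd poly_pcompose q_def poly_monom)
  qed simp
  then have "[:0, 1:] * pcompose c q = 0" using poly_all_0_iff_0 by blast
  then have "pcompose c q = 0" by simp
  moreover have "degree q > 0" using m by (simp add: q_def degree_monom_eq)
  ultimately have "c = 0" by (rule pcompose_eq_0)
  with v nonzero show ?thesis by simp
qed

text \<open>The slice lemma places \<open>(f * h) ^ j * g\<close> in \<open>A\<close>; the two
  descents then remove one factor f and one factor h at a time.\<close>

lemma kernel_E:
  assumes "E g = 0"
  shows "g \<in> A"
proof -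
  note D = Jac_derivation[of f h]
  obtain j where j: "(f * h) ^ j * g \<in> alg_gen {f, h, r}" using localised_slice by blast
  have Er: "E (E r) = 0" "E r \<noteq> 0"
    using nonzero by (simp_all add: E_r deriv_rules[OF D] E_f E_h)
  have "{f, h, r} \<subseteq> alg_gen (insert r A)" by (auto intro!: alg_gen.gen)
  then have "(f * h) ^ j * g \<in> alg_gen (insert r A)"
    using j alg_gen_least subalg_alg_gen by blast
  moreover have "E ((f * h) ^ j * g) = 0"
    by (simp add: deriv_rules[OF D] E_f E_h assms)
  ultimately have "(f * h) ^ j * g \<in> A"
    using kernel_in_extension_by_local_slice[OF D subalg_alg_gen _ Er] kernel_A by blast
  then show ?thesis
  proof (induction j)
    case (Suc j)
    then have "f * (h * ((f * h) ^ j * g)) \<in> A" by (simp add: mult_ac)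
    then show ?case using descent_f descent_h Suc.IH by blast
  qed simp
qed

section \<open>Gradients on the lines x = y = 0 and y = z = 0\<close>

text \<open>On x = y = 0 the elements f, r and w vanish, w together with its gradient, so to first
  order h is p(0) r^(m-1) and r is p(0) x. The factor \<open>0 ^ (m - 2)\<close> is 1 for m = 2 and
  0 otherwise.\<close>

lemma gradients_line:
  "ev 0 0 z (dX f) = z" "ev 0 0 z (dY f) = 0" "ev 0 0 z (dZ f) = 0"
  "ev 0 0 z (dX h) = poly (poly F 0) 0 ^ 2 * (of_nat (m - 1) * 0 ^ (m - 2))"
  "ev 0 0 z (dY h) = 0" "ev 0 0 z (dZ h) = 0"
  "ev 0 0 z f = 0" "ev 0 0 z h = 0"
proof -
  show f: "ev 0 0 z f = 0" using m by (simp add: f_def)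
  have y: "(0::'k) ^ (m - 1) = 0" using m by simp
  show "ev 0 0 z (dX f) = z" "ev 0 0 z (dY f) = 0" "ev 0 0 z (dZ f) = 0"
    using y by (simp_all add: f_def deriv_rules[OF dX_derivation] deriv_rules[OF dY_derivation] deriv_rules[OF dZ_derivation])
  obtain T where T: "S = r ^ (m - 1) + w * T" using S_split by blast
  have r: "ev 0 0 z r = 0" by (simp add: r_def)
  have G: "ev 0 0 z G = poly (poly F 0) 0" by (simp add: ev_eval2 f)
  \<comment> \<open>With mn at least 2, the power f^(mn) vanishes on the line together with its
    gradient, so the term z f^(mn) contributes nothing.\<close>
  have "2 * 1 \<le> m * n" using m n by (rule mult_le_mono)
  then have mn: "m * n \<noteq> 0" "m * n - 1 \<noteq> 0" by linarith+
  show "ev 0 0 z h = 0" using m mn(1) by (simp add: h_eq T f r power_0_left)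
  have D: "ev 0 0 z (D h) = poly (poly F 0) 0 ^ 2 * (of_nat (m - 1) * 0 ^ (m - 2)) * ev 0 0 z (D varX)"
    if D: "is_derivation D" for D
  proof -
    have Dr: "ev 0 0 z (D r) = poly (poly F 0) 0 * ev 0 0 z (D varX)"
      using n by (simp add: r_def deriv_rules[OF D] G f)
    have "ev 0 0 z (D S) = of_nat (m - 1) * 0 ^ (m - 1 - 1) * ev 0 0 z (D r)"
      using n by (simp add: T deriv_rules[OF D] r f)
    moreover have fmn: "ev 0 0 z (f ^ (m * n)) = 0" "ev 0 0 z (D (f ^ (m * n))) = 0"
      by (simp_all only: deriv_power[OF D] ev_simps f power_0_left mn if_False mult_zero_left mult_zero_right)
    moreover have "ev 0 0 z S = 0" using m n by (simp add: T r f)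
    ultimately have "ev 0 0 z (D h) = poly (poly F 0) 0 * (of_nat (m - 1) * 0 ^ (m - 1 - 1) * ev 0 0 z (D r))"
      by (simp add: h_eq deriv_add[OF D] deriv_mult[OF D] G fmn del: ev_simps(4))
    moreover have "m - 1 - 1 = m - 2" by simp
    ultimately show ?thesis by (simp add: Dr power2_eq_square mult_ac)
  qed
  show "ev 0 0 z (dX h) = poly (poly F 0) 0 ^ 2 * (of_nat (m - 1) * 0 ^ (m - 2))"
    "ev 0 0 z (dY h) = 0" "ev 0 0 z (dZ h) = 0"
    using D[OF dX_derivation] D[OF dY_derivation] D[OF dZ_derivation] by simp_all
qed

text \<open>Restriction to y = z = 0 is kept as a polynomial in x, so that one can reduce modulo p
  even when p has no root in k.\<close>

definition axis :: "'k poly3 \<Rightarrow> 'k poly" where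
  "axis u = poly (poly u 0) 0"

lemma axis_simps [simp]:
  "axis (u + v) = axis u + axis v" "axis (u - v) = axis u - axis v"
  "axis (u * v) = axis u * axis v" "axis (u ^ j) = axis u ^ j" "axis 1 = 1" "axis 0 = 0"
  "axis (of_nat j) = of_nat j"
  "axis (constB c) = [:c:]" "axis varX = [:0, 1:]"
  by (simp_all add: axis_def constB_def varX_def)

lemma poly_axis: "poly (axis u) s = ev s 0 0 u"
  by (simp add: ev_def axis_def)

lemma axis_data: "axis f = 0" "axis r = [:0, 1:] * poly F 0"
  "axis h = [:0, 1:] ^ (m - 1) * poly F 0 ^ m"
  by (simp_all add: poly_eq_poly_eq_iff[symmetric] fun_eq_iff poly_axis ev_axis)

text \<open>Apply \<open>D\<close> to the relation for xh and restrict to the axis: f vanishes and p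
  divides both h and r^(m-1), so p divides x times \<open>D h\<close>. Since p(0) is nonzero, p is
  prime to x.\<close>

lemma dvd_axis_gradient:
  assumes D: "is_derivation D" and p0: "poly (poly F 0) 0 \<noteq> 0"
  shows "poly F 0 dvd axis (D h)"
proof -
  let ?p = "poly F 0"
  have "axis (D (varX * h)) = axis (of_nat m * r ^ (m - 1) * D r)"
    unfolding h_def using m n by (simp add: deriv_rules[OF D] axis_data)
  then have "[:0, 1:] * axis (D h) =
      axis (of_nat m * r ^ (m - 1) * D r) - axis h * axis (D varX)"
    by (simp add: deriv_rules[OF D] algebra_simps)
  moreover have "?p dvd axis h"
    using m by (simp add: axis_data dvd_mult dvd_power)
  moreover have "axis r dvd axis r ^ (m - 1)" using m by (intro dvd_power) simp
  then have "?p dvd axis r ^ (m - 1)"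
    by (rule dvd_trans[rotated]) (simp only: axis_data(2) dvd_triv_right)
  ultimately have "?p dvd [:0, 1:] * axis (D h)" by simp
  \<comment> \<open>Writing p = c + xq makes the coprimality explicit: c = p - qx.\<close>
  moreover obtain c q where p: "?p = pCons c q" by (cases ?p) auto
  have "smult c (axis (D h)) = ?p * axis (D h) - q * ([:0, 1:] * axis (D h))"
    unfolding p by (simp add: algebra_simps)
  ultimately have "?p dvd smult c (axis (D h))" by (metis dvd_diff dvd_mult dvd_triv_left)
  moreover have "c \<noteq> 0" using p0 p by simp
  ultimately show ?thesis by (simp add: dvd_smult_iff)
qed

lemma no_variable_in_kernel:
  assumes "coord_system g1 g2 g" "E g = 0"
  shows False
proof -
  \<comment> \<open>The generator \<open>h\<close> is repeated to fit the three-generator chain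
    rule; its two coefficients are added to form \<beta>.\<close>
  have g: "g \<in> alg_gen {f, h, h}" using kernel_E[OF assms(2)] by simp
  obtain \<alpha> \<beta>1 \<beta>2 where mem: "\<alpha> \<in> A" "\<beta>1 \<in> A" "\<beta>2 \<in> A"
    and grad: "\<And>D. is_derivation D \<Longrightarrow> D g = \<alpha> * D f + \<beta>1 * D h + \<beta>2 * D h"
    using chain_rule_alg_gen[OF g] by auto
  define \<beta> where "\<beta> = \<beta>1 + \<beta>2"
  have "\<beta> \<in> A" unfolding \<beta>_def by (intro alg_gen.add mem)
  then obtain b v' w' where \<beta>: "\<beta> = constB b + f * v' + h * w'"
    using alg_gen_constant_term by blast
  obtain a v w where \<alpha>: "\<alpha> = constB a + f * v + h * w"
    using alg_gen_constant_term[OF mem(1)] by blast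
  obtain d where d: "1 = Jac g1 g2 g * d"
    using Jac_coord_system_unit[OF assms(1)] by (auto elim: dvdE)
  \<comment> \<open>Expanding the unit Jacobian along the row of \<open>g\<close> expresses 1 as a
    combination of the partial derivatives of \<open>g\<close>.\<close>
  define s1 s2 s3 where "s1 = d * (dY g1 * dZ g2 - dZ g1 * dY g2)"
    and "s2 = d * (dZ g1 * dX g2 - dX g1 * dZ g2)"
    and "s3 = d * (dX g1 * dY g2 - dY g1 * dX g2)"
  have "1 = s1 * dX g + s2 * dY g + s3 * dZ g"
    unfolding d s1_def s2_def s3_def Jac_def by algebra
  then have unit: "1 = \<alpha> * (s1 * dX f + s2 * dY f + s3 * dZ f) + \<beta> * (s1 * dX h + s2 * dY h + s3 * dZ h)"
    by (simp add: grad[OF dX_derivation] grad[OF dY_derivation] grad[OF dZ_derivation] \<beta>_def algebra_simps)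
  define e where "e = poly (poly F 0) 0 ^ 2 * (of_nat (m - 1) * 0 ^ (m - 2))"
  \<comment> \<open>On x = y = 0 only the x-derivatives survive, and \<alpha>, \<beta> reduce to
    their constant terms; hence az + be has no zero in k.\<close>
  have line: "1 = ev 0 0 z s1 * (a * z + b * e)" for z
  proof -
    have "ev 0 0 z 1 = ev 0 0 z s1 * (a * z + b * e)"
      by (subst unit) (simp add: \<alpha> \<beta> gradients_line e_def algebra_simps)
    then show ?thesis by simp
  qed
  show False
  proof (cases "poly (poly F 0) 0 = 0")
    case True
    then show False using line[of 0] by (simp add: e_def)
  next
    case False
    \<comment> \<open>If a = 0, then on the axis \<alpha> is a multiple of h, so p divides it as
      well as the gradient of h; hence p divides 1, contrary to its positive degree.\<close>
    have "a \<noteq> 0"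
    proof
      assume "a = 0"
      have "poly F 0 dvd axis h" using m by (simp add: axis_data dvd_mult dvd_power)
      moreover have "axis 1 = axis h * axis w * axis (s1 * dX f + s2 * dY f + s3 * dZ f)
          + axis \<beta> * (axis s1 * axis (dX h) + axis s2 * axis (dY h) + axis s3 * axis (dZ h))"
        by (subst unit) (simp add: \<alpha> \<open>a = 0\<close> axis_data)
      ultimately have "poly F 0 dvd axis 1"
        using dvd_axis_gradient[OF dX_derivation False] dvd_axis_gradient[OF dY_derivation False]
          dvd_axis_gradient[OF dZ_derivation False]
        by (metis dvd_add dvd_mult dvd_mult2)
      moreover have "poly F 0 \<noteq> 0" using p_nonconst by auto
      ultimately show False using p_nonconst by (simp add: is_unit_iff_degree)
    qed
    then show False using line[of "- (b * e / a)"] by simp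
  qed
qed

lemma deriv_rank_E: "deriv_rank E = 3"
proof -
  note D = Jac_derivation[of f h]
  let ?P = "\<lambda>i. \<exists>g1 g2 g3. coord_system g1 g2 g3 \<and>
    alg_gen (set (drop i [g1, g2, g3])) \<subseteq> {p. E p = 0}"
  \<comment> \<open>Dropping all three coordinates leaves only the constants, which lie in the
    kernel.\<close>
  have "?P 3"
    using coord_system_variables alg_gen_least[OF subalg_kernel[OF D], of "{}"] by fastforce
  moreover have "3 \<le> i" if "?P i" for i
  proof (rule ccontr)
    assume "\<not> 3 \<le> i"
    from that obtain g1 g2 g3 where g: "coord_system g1 g2 g3"
      "alg_gen (set (drop i [g1, g2, g3])) \<subseteq> {p. E p = 0}" by (elim exE conjE)
    have "i = 0 \<or> i = 1 \<or> i = 2" using \<open>\<not> 3 \<le> i\<close> by auto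
    \<comment> \<open>For every i below 3 the remaining list still ends in \<open>g3\<close>, so
      this one variable excludes all smaller ranks.\<close>
    then have "g3 \<in> set (drop i [g1, g2, g3])" by auto
    then have "E g3 = 0" using g(2) alg_gen.gen by blast
    then show False using no_variable_in_kernel g(1) by blast
  qed
  ultimately show ?thesis unfolding deriv_rank_def by (rule Least_equality)
qed

end

theorem theorem5p7:
  fixes F :: "'k::field_char_0 poly poly" and m n :: nat
    and f r h :: "'k poly3"
  assumes "m \<ge> 2" and "n \<ge> 1"
    and "poly F 0 \<notin> range (\<lambda>c. [:c:])"
    and "f = varX * varZ - varY ^ m"
    and "r = varX * eval2 F varX f + varY * f ^ n"
    and "varX * h = f ^ (m * n + 1) + r ^ m"
  shows "is_derivation (Jac f h) \<and> locally_nilpotent (Jac f h) \<and> deriv_rank (Jac f h) = 3"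
proof -
  interpret rank3_data F m n f r h
    by unfold_locales (fact assms)+
  show ?thesis
    using Jac_derivation locally_nilpotent_E deriv_rank_E by blast
qed

end
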